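(* Let $\Omega\subset\mathbb{R}^d$ be a compact convex set with nonempty interior and let $\lambda>0$. Consider the functional on $\mathcal{P}(\Omega)\times\mathcal{P}(\Omega)$ $$\mathfrak{F}(\mu,\nu)=\frac12W_2^2(\mu,\nu)+\frac12\|\mu\|_{L^2(\Omega)}^2+\int_{\Omega\times\Omega}\frac{\lambda}{2}|x-y|^2\,\nu(dx)\,\nu(dy).$$ For any pair of minimizers $(\mu,\nu)$ of $\mathfrak{F}$ there exist a point $x_0$ and a radius $r>0$ such that: (i) $\mu$ is concentrated on $B(x_0,r)\cap\Omega$ and has there the density $u(x)=\frac{\lambda}{2\lambda+1}\left(r^2-|x-x_0|^2\right)$; (ii) $\nu$ is concentrated on the ball $B\left(x_0,\frac{r}{2\lambda+1}\right)$ and is the image (push-forward) of $\mu$ under the homothety of center $x_0$ and ratio $(2\lambda+1)^{-1}$; (iii) $x_0$ is the barycenter of $\nu$, i.e. $x_0=\int_\Omega y\,\nu(dy)$.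
   Context: $\mathcal{P}(\Omega)$ is the set of Borel probability measures on $\Omega$. $\|\mu\|_{L^2(\Omega)}^2=\int_\Omega u^2\,d\mathcal{L}^d$ if $\mu=u\cdot\mathcal{L}^d$ is absolutely continuous with respect to the Lebesgue measure $\mathcal{L}^d$, and $+\infty$ otherwise. $W_2$ is the 2-Wasserstein distance: $W_2^2(\mu,\nu)=\min\{\int_{\Omega\times\Omega}|x-y|^2\,d\gamma\}$ over all $\gamma\in\mathcal{P}(\Omega\times\Omega)$ with marginals $\mu$ and $\nu$. $B(x,\rho)$ is the ball of center $x$ and radius $\rho$. *)

theory Defs
  imports "HOL-Probability.Probability"
begin

(* Measures on the subspace \<Omega> itself: their space is \<Omega>, and no mass lies outside. *)
definition borel_probs :: "'a::euclidean_space set \<Rightarrow> 'a measure set"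
  where "borel_probs \<Omega> = space (prob_algebra (restrict_space borel \<Omega>))"

definition transport_plans ::
  "'a::euclidean_space set \<Rightarrow> 'a measure \<Rightarrow> 'a measure \<Rightarrow> ('a \<times> 'a) measure set"
  where "transport_plans \<Omega> \<mu> \<nu> =
    {\<gamma> \<in> borel_probs (\<Omega> \<times> \<Omega>).
       distr \<gamma> (restrict_space borel \<Omega>) fst = \<mu> \<and> distr \<gamma> (restrict_space borel \<Omega>) snd = \<nu>}"

(* The infimum is a minimum for compact \<Omega>; attainment is not part of the definition. *)
definition W2_squared :: "'a::euclidean_space set \<Rightarrow> 'a measure \<Rightarrow> 'a measure \<Rightarrow> ennreal"
  where "W2_squared \<Omega> \<mu> \<nu> =
    (INF \<gamma>\<in>transport_plans \<Omega> \<mu> \<nu>. \<integral>\<^sup>+ (x, y). ennreal ((norm (x - y))\<^sup>2) \<partial>\<gamma>)"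

(* RN_deriv is determined only almost everywhere, which does not affect the integral. *)
definition L2_norm_squared :: "'a::euclidean_space set \<Rightarrow> 'a measure \<Rightarrow> ennreal"
  where "L2_norm_squared \<Omega> \<mu> =
    (let L = restrict_space lborel \<Omega> in
     if absolutely_continuous L \<mu> then \<integral>\<^sup>+ x. (RN_deriv L \<mu> x)\<^sup>2 \<partial>L else \<infinity>)"

definition functional_F ::
  "'a::euclidean_space set \<Rightarrow> real \<Rightarrow> 'a measure \<Rightarrow> 'a measure \<Rightarrow> ennreal"
  where "functional_F \<Omega> l \<mu> \<nu> =
    W2_squared \<Omega> \<mu> \<nu> / 2 + L2_norm_squared \<Omega> \<mu> / 2
    + (\<integral>\<^sup>+ (x, y). ennreal (l / 2 * (norm (x - y))\<^sup>2) \<partial>(\<nu> \<Otimes>\<^sub>M \<nu>))"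

end

theory Submission imports Defs begin

text \<open>
  Let \<open>b\<close> be the barycenter of \<open>\<nu>\<close>, let \<open>T\<close> be the homothety with center \<open>b\<close> and ratio
  \<open>1 / (2 l + 1)\<close>, and put \<open>k = l / (2 l + 1)\<close>. The interaction energy of \<open>\<nu>\<close> is \<open>l\<close> times its
  variance \<open>\<integral> |y - b|\<^sup>2 d\<nu>\<close>, so for every transport plan \<open>\<gamma>\<close> the first and third terms of the
  functional combine into one integral against \<open>\<gamma>\<close>, and completing the square in \<open>y\<close> gives
  \<open>|x - y|\<^sup>2 / 2 + l |y - b|\<^sup>2 = k |x - b|\<^sup>2 + (2 l + 1) / 2 \<cdot> |y - T x|\<^sup>2\<close>.
  Hence the functional at \<open>(\<mu>, \<nu>)\<close> equals \<open>E(\<mu>) + (2 l + 1) / 2 \<cdot> inf\<^sub>\<gamma> \<integral> |y - T x|\<^sup>2 d\<gamma>\<close>,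
  where \<open>E(\<mu>) = \<parallel>\<mu>\<parallel>\<^sup>2 / 2 + k \<integral> |x - b|\<^sup>2 d\<mu>\<close> involves \<open>\<mu>\<close> alone.

  Conversely the pair of a measure \<open>\<mu>'\<close> and its image under \<open>T\<close> has energy at most \<open>E(\<mu>')\<close>: the
  barycenter of that image may differ from \<open>b\<close>, but the second moment about \<open>b\<close> is never smaller
  than the variance. Convexity of \<open>\<Omega>\<close> puts \<open>b\<close> in \<open>\<Omega>\<close>, so that \<open>T\<close> maps \<open>\<Omega>\<close> into itself and the
  pair is admissible.

  The energy \<open>E\<close> is strictly convex, and its minimizer is the density
  \<open>v = max 0 (c - k |x - b|\<^sup>2)\<close> with \<open>c\<close> chosen such that the mass is one. Quantitatively, a density
  \<open>u\<close> of mass one satisfies \<open>E(u) \<ge> E(v) + \<parallel>u - v\<parallel>\<^sup>2 / 2\<close>. Comparing \<open>(\<mu>, \<nu>)\<close> with \<open>v\<close> and its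
  image under \<open>T\<close> therefore yields, for the density \<open>u\<close> of \<open>\<mu>\<close>,
  \<open>\<parallel>u - v\<parallel>\<^sup>2 / 2 + (2 l + 1) / 2 \<cdot> inf\<^sub>\<gamma> \<integral> |y - T x|\<^sup>2 d\<gamma> \<le> 0\<close>.
  Both terms vanish. The first gives the density of \<open>\<mu>\<close>, with \<open>r = sqrt (c / k)\<close>, and the second
  makes \<open>\<nu>\<close> the image of \<open>\<mu>\<close> under \<open>T\<close>. Plans for which the integral is arbitrarily
  small force Lipschitz test functions to have equal integrals against \<open>\<nu>\<close> and the image of \<open>\<mu>\<close>.

  The steps are carried by \<open>interaction_energy_eq\<close>, \<open>quadratic_cost_complete_square\<close>,
  \<open>functional_F_homothety_le\<close>, \<open>ex_near_optimal_plan\<close>, \<open>truncated_potential_strictly_optimal\<close>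
  and \<open>distr_eqI_transport_plans\<close>.
\<close>

section \<open>Probability measures on a compact set\<close>

lemma borel_probsD:
  assumes "M \<in> borel_probs K"
  shows borel_probs_prob_space: "prob_space M"
    and borel_probs_sets: "sets M = sets (restrict_space borel K)"
    and borel_probs_space: "space M = K"
  using assms sets_eq_imp_space_eq[of M "restrict_space borel K"]
  by (auto simp: borel_probs_def space_prob_algebra space_restrict_space)

lemma borel_probsI:
  "prob_space M \<Longrightarrow> sets M = sets (restrict_space borel K) \<Longrightarrow> M \<in> borel_probs K"
  by (simp add: borel_probs_def space_prob_algebra)

lemma borel_probs_measurable:
  assumes "M \<in> borel_probs K" "f \<in> borel_measurable borel"
  shows "f \<in> borel_measurable M"
proof -
  have "f \<in> borel_measurable (restrict_space borel K)"
    using assms(2) by (rule measurable_restrict_space1)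
  then show ?thesis
    using borel_probs_sets[OF assms(1)] by (simp cong: measurable_cong_sets)
qed

lemma borel_probs_measurable_restrict:
  assumes "M \<in> borel_probs K" "f \<in> borel_measurable borel" "f ` K \<subseteq> K'"
  shows "f \<in> measurable M (restrict_space borel K')"
proof -
  have "f \<in> measurable (restrict_space borel K) (restrict_space borel K')"
    using assms(2,3) by (intro measurable_restrict_space3) auto
  then show ?thesis
    using borel_probs_sets[OF assms(1)] by (simp cong: measurable_cong_sets)
qed

lemma borel_probs_distr:
  assumes "M \<in> borel_probs K" "f \<in> borel_measurable borel" "f ` K \<subseteq> K'"
  shows "distr M (restrict_space borel K') f \<in> borel_probs K'"
  using prob_space.prob_space_distr[OF borel_probs_prob_space[OF assms(1)]
      borel_probs_measurable_restrict[OF assms]]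
  by (intro borel_probsI) simp_all

lemma integrable_continuous_borel_probs:
  fixes f :: "'b::euclidean_space \<Rightarrow> 'c::euclidean_space"
  assumes M: "M \<in> borel_probs K" and K: "compact K" and f: "continuous_on UNIV f"
  shows "integrable M f"
proof -
  interpret prob_space M by (rule borel_probs_prob_space[OF M])
  have "compact (f ` K)"
    using K f by (intro compact_continuous_image) (auto intro: continuous_on_subset)
  then obtain B where "\<forall>y\<in>f ` K. norm y \<le> B"
    using compact_imp_bounded bounded_iff by blast
  then have "AE x in M. norm (f x) \<le> B"
    by (intro AE_I2) (auto simp: borel_probs_space[OF M])
  moreover have "f \<in> borel_measurable M"
    by (intro borel_probs_measurable[OF M] borel_measurable_continuous_onI f)
  ultimately show ?thesis by (rule integrable_const_bound)
qed

text \<open>Otherwise a hyperplane separates the barycenter from \<open>K\<close>, and integrating the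
  corresponding linear inequality over \<open>K\<close> gives a contradiction.\<close>

lemma barycenter_in_convex:
  fixes \<nu> :: "'b::euclidean_space measure"
  assumes \<nu>: "\<nu> \<in> borel_probs K" and K: "compact K" "convex K"
  shows "(LINT y|\<nu>. y) \<in> K"
proof (rule ccontr)
  interpret prob_space \<nu> by (rule borel_probs_prob_space[OF \<nu>])
  assume "(LINT y|\<nu>. y) \<notin> K"
  then obtain a c where ac: "inner a (LINT y|\<nu>. y) < c" "\<forall>x\<in>K. inner a x > c"
    using separating_hyperplane_closed_point[OF K(2) compact_imp_closed[OF K(1)]] by blast
  have int: "integrable \<nu> (\<lambda>y. y)" "integrable \<nu> (\<lambda>y. inner a y)"
    by (intro integrable_continuous_borel_probs[OF \<nu> K(1)] continuous_intros)+
  have "c = (LINT y|\<nu>. c)" by (simp add: prob_space)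
  also have "\<dots> \<le> (LINT y|\<nu>. inner a y)"
    using int ac(2) by (intro integral_mono) (auto simp: borel_probs_space[OF \<nu>] intro: less_imp_le)
  also have "\<dots> = inner a (LINT y|\<nu>. y)"
    using int by simp
  finally show False using ac(1) by simp
qed

lemma nn_integral_continuous_borel_probs:
  fixes f :: "'b::euclidean_space \<Rightarrow> real"
  assumes "M \<in> borel_probs K" "compact K" "continuous_on UNIV f" "\<And>x. 0 \<le> f x"
  shows "(\<integral>\<^sup>+x. ennreal (f x) \<partial>M) = ennreal (LINT x|M. f x)"
  using assms by (intro nn_integral_eq_integral integrable_continuous_borel_probs) auto

text \<open>Expanding the square about \<open>a\<close> makes the double integral factorize, since the mixed term only
  sees the first moment. With \<open>a\<close> the barycenter this is the variance; a general \<open>a\<close> shows that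
  the second moment about any point is an upper bound.\<close>

lemma interaction_energy_eq:
  fixes \<nu> :: "'b::euclidean_space measure"
  assumes \<nu>: "\<nu> \<in> borel_probs K" and K: "compact K" and l: "0 \<le> l"
  shows "(\<integral>\<^sup>+ (x, y). ennreal (l / 2 * (norm (x - y))\<^sup>2) \<partial>(\<nu> \<Otimes>\<^sub>M \<nu>)) =
    ennreal (l * ((LINT y|\<nu>. (norm (y - a))\<^sup>2) - (norm ((LINT y|\<nu>. y) - a))\<^sup>2))"
proof -
  interpret prob_space \<nu> by (rule borel_probs_prob_space[OF \<nu>])
  let ?b = "LINT y|\<nu>. y" and ?V = "LINT y|\<nu>. (norm (y - a))\<^sup>2"
  note int = integrable_continuous_borel_probs[OF \<nu> K]
  note nn = nn_integral_continuous_borel_probs[OF \<nu> K]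
  have i1: "integrable \<nu> (\<lambda>y. y - a)" "integrable \<nu> (\<lambda>y. y)" "integrable \<nu> (\<lambda>y. (norm (y - a))\<^sup>2)"
    by (intro int continuous_intros)+
  have b: "(LINT y|\<nu>. y - a) = ?b - a"
    using i1 by (simp add: prob_space)
  have i2: "integrable \<nu> (\<lambda>y. inner c (y - a))" "(LINT y|\<nu>. inner c (y - a)) = inner c (?b - a)" for c
    using i1(1) b by (auto intro: integrable_inner_right simp: integral_inner_right)
  have expand: "l / 2 * (norm (x - y))\<^sup>2 =
      l / 2 * (norm (x - a))\<^sup>2 - l * inner (x - a) (y - a) + l / 2 * (norm (y - a))\<^sup>2" for x y :: 'b
    unfolding power2_norm_eq_inner by (simp add: inner_simps inner_commute algebra_simps)
  have inner_int: "(LINT y|\<nu>. l / 2 * (norm (x - y))\<^sup>2) =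
      l / 2 * (norm (x - a))\<^sup>2 - l * inner (x - a) (?b - a) + l / 2 * ?V" for x
  proof -
    have "(LINT y|\<nu>. l / 2 * (norm (x - y))\<^sup>2) = (LINT y|\<nu>. l / 2 * (norm (x - a))\<^sup>2
        - l * inner (x - a) (y - a) + l / 2 * (norm (y - a))\<^sup>2)"
      by (rule Bochner_Integration.integral_cong[OF refl expand])
    also have "\<dots> = (LINT y|\<nu>. l / 2 * (norm (x - a))\<^sup>2) - (LINT y|\<nu>. l * inner (x - a) (y - a))
        + (LINT y|\<nu>. l / 2 * (norm (y - a))\<^sup>2)"
      using i1 i2
      by (subst Bochner_Integration.integral_add Bochner_Integration.integral_diff; simp)+
    finally show ?thesis by (simp add: i2 prob_space)
  qed
  have meas: "(\<lambda>(x, y). ennreal (l / 2 * (norm (x - y))\<^sup>2)) \<in> borel_measurable (\<nu> \<Otimes>\<^sub>M \<nu>)"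
  proof -
    have [measurable]: "(\<lambda>x. x) \<in> borel_measurable \<nu>"
      by (intro borel_probs_measurable[OF \<nu>]) simp
    have [measurable]: "fst \<in> borel_measurable (\<nu> \<Otimes>\<^sub>M \<nu>)" "snd \<in> borel_measurable (\<nu> \<Otimes>\<^sub>M \<nu>)"
      by (rule measurable_compose[OF measurable_fst], simp) (rule measurable_compose[OF measurable_snd], simp)
    show ?thesis unfolding case_prod_beta by measurable
  qed
  have "(\<integral>\<^sup>+ (x, y). ennreal (l / 2 * (norm (x - y))\<^sup>2) \<partial>(\<nu> \<Otimes>\<^sub>M \<nu>)) =
      (\<integral>\<^sup>+ x. \<integral>\<^sup>+ y. ennreal (l / 2 * (norm (x - y))\<^sup>2) \<partial>\<nu> \<partial>\<nu>)"
    using nn_integral_fst[OF meas] by simp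
  also have "\<dots> = (\<integral>\<^sup>+ x. ennreal (LINT y|\<nu>. l / 2 * (norm (x - y))\<^sup>2) \<partial>\<nu>)"
    using l by (intro nn_integral_cong nn continuous_intros) auto
  also have "\<dots> = ennreal (LINT x|\<nu>. LINT y|\<nu>. l / 2 * (norm (x - y))\<^sup>2)"
  proof (rule nn)
    show "continuous_on UNIV (\<lambda>x. LINT y|\<nu>. l / 2 * (norm (x - y))\<^sup>2)"
      unfolding inner_int by (intro continuous_intros)
    show "0 \<le> (LINT y|\<nu>. l / 2 * (norm (x - y))\<^sup>2)" for x
      using l by (intro integral_nonneg_AE) auto
  qed
  also have "(LINT x|\<nu>. LINT y|\<nu>. l / 2 * (norm (x - y))\<^sup>2) =
      l / 2 * ?V - l * inner (?b - a) (?b - a) + l / 2 * ?V"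
  proof -
    have "(LINT x|\<nu>. LINT y|\<nu>. l / 2 * (norm (x - y))\<^sup>2) =
        (LINT x|\<nu>. l / 2 * (norm (x - a))\<^sup>2) - (LINT x|\<nu>. l * inner (?b - a) (x - a))
        + (LINT x|\<nu>. l / 2 * ?V)"
      unfolding inner_int inner_commute[of _ "?b - a"] using i1 i2
      by (subst Bochner_Integration.integral_add Bochner_Integration.integral_diff; simp)+
    then show ?thesis by (simp add: i2 prob_space)
  qed
  also have "\<dots> = l * (?V - (norm (?b - a))\<^sup>2)"
    by (simp add: power2_norm_eq_inner algebra_simps)
  finally show ?thesis .
qed

section \<open>Equality of measures by Lipschitz test functions\<close>

text \<open>The indicator of a nonempty closed set \<open>C\<close> is the limit of the Lipschitz functions
  \<open>max 0 (1 - n dist(x, C))\<close>, and closed sets generate the Borel sets.\<close>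

lemma finite_measure_eqI_lipschitz:
  fixes M N :: "'b::metric_space measure"
  assumes fin: "finite_measure M" "finite_measure N"
    and sets: "sets M = sets borel" "sets N = sets borel"
    and eq: "\<And>f::'b \<Rightarrow> real. \<And>C. C-lipschitz_on UNIV f \<Longrightarrow> (\<And>x. 0 \<le> f x \<and> f x \<le> 1) \<Longrightarrow>
      (LINT x|M. f x) = (LINT x|N. f x)"
  shows "M = N"
proof -
  interpret M: finite_measure M by fact
  interpret N: finite_measure N by fact
  have closed_eq: "measure M C = measure N C" if C: "closed C" for C
  proof (cases "C = {}")
    case False
    define f where "f n x = max 0 (1 - real n * infdist x C)" for n :: nat and x
    have lip: "(real n)-lipschitz_on UNIV (f n)" for n
    proof (rule lipschitz_onI)
      fix x y :: 'b
      have "real n * infdist x C \<le> real n * infdist y C + real n * dist x y"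
        "real n * infdist y C \<le> real n * infdist x C + real n * dist x y"
        using infdist_triangle[of x C y] infdist_triangle[of y C x]
        by (auto simp: distrib_left[symmetric] dist_commute intro!: mult_left_mono)
      then show "dist (f n x) (f n y) \<le> real n * dist x y"
        unfolding f_def dist_real_def by linarith
    qed simp
    have f01: "0 \<le> f n x \<and> f n x \<le> 1" for n x
      by (simp add: f_def infdist_nonneg)
    have lim: "(\<lambda>n. f n x) \<longlonglongrightarrow> indicator C x" for x
    proof (cases "x \<in> C")
      case True
      then show ?thesis by (simp add: f_def)
    next
      case x: False
      then have pos: "infdist x C > 0"
        using in_closed_iff_infdist_zero[OF C False] infdist_nonneg[of x C] by (metis less_le)
      obtain m :: nat where m: "1 / infdist x C < real m" using reals_Archimedean2 by blast
      have "f n x = 0" if "n \<ge> m" for n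
      proof -
        have "1 / infdist x C < real n" using m that by simp
        then show ?thesis using pos by (simp add: f_def field_simps)
      qed
      then have "\<forall>\<^sub>F n in sequentially. f n x = 0"
        by (auto simp: eventually_sequentially)
      then show ?thesis using x by (simp add: tendsto_eventually)
    qed
    have conv: "(\<lambda>n. LINT x|P. f n x) \<longlonglongrightarrow> measure P C"
      if P: "finite_measure P" "sets P = sets borel" for P
    proof -
      interpret finite_measure P by fact
      have meas: "g \<in> borel_measurable P \<longleftrightarrow> g \<in> borel_measurable borel" for g :: "'b \<Rightarrow> real"
        using P(2) by (simp cong: measurable_cong_sets)
      have "(\<lambda>n. LINT x|P. f n x) \<longlonglongrightarrow> (LINT x|P. indicator C x :: real)"
      proof (rule integral_dominated_convergence[where w = "\<lambda>_. 1"])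
        show "f n \<in> borel_measurable P" for n
          unfolding meas
          by (intro borel_measurable_continuous_onI lipschitz_on_continuous_on[OF lip])
      qed (use C f01 lim P in \<open>auto simp: meas\<close>)
      also have "(LINT x|P. indicator C x :: real) = measure P C"
        using C P(2) by (simp add: sets_eq_imp_space_eq[OF P(2)])
      finally show ?thesis .
    qed
    show ?thesis
      using conv[OF fin(1) sets(1)] conv[OF fin(2) sets(2)] eq[OF lip f01]
      by (intro LIMSEQ_unique) auto
  qed simp
  show ?thesis
  proof (rule measure_eqI_generator_eq[where E = "Collect closed" and \<Omega> = UNIV and A = "\<lambda>_. UNIV"])
    show "sets M = sigma_sets UNIV (Collect closed)" "sets N = sigma_sets UNIV (Collect closed)"
      using sets by (simp_all add: borel_eq_closed)
  qed (auto simp: Int_stable_def M.emeasure_eq_measure N.emeasure_eq_measure closed_eq)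
qed

text \<open>Measures living on a closed set \<open>K\<close> are compared through their extensions by zero to the
  whole space.\<close>

lemma borel_probs_eqI_lipschitz:
  fixes M N :: "'b::euclidean_space measure"
  assumes M: "M \<in> borel_probs K" and N: "N \<in> borel_probs K" and K: "closed K"
    and eq: "\<And>f::'b \<Rightarrow> real. \<And>C. C-lipschitz_on UNIV f \<Longrightarrow> (\<And>x. 0 \<le> f x \<and> f x \<le> 1) \<Longrightarrow>
      (LINT x|M. f x) = (LINT x|N. f x)"
  shows "M = N"
proof (rule measure_eqI)
  have id: "(\<lambda>x. x) \<in> borel_measurable P" if "P \<in> borel_probs K" for P :: "'b measure"
    using that by (rule borel_probs_measurable) simp
  have same: "distr M borel (\<lambda>x. x) = distr N borel (\<lambda>x. x)"
  proof (rule finite_measure_eqI_lipschitz)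
    fix f :: "'b \<Rightarrow> real" and C assume f: "C-lipschitz_on UNIV f" "\<And>x. 0 \<le> f x \<and> f x \<le> 1"
    have "f \<in> borel_measurable borel"
      by (intro borel_measurable_continuous_onI lipschitz_on_continuous_on[OF f(1)])
    then show "(LINT x|distr M borel (\<lambda>x. x). f x) = (LINT x|distr N borel (\<lambda>x. x). f x)"
      using eq[OF f] M N by (simp add: integral_distr id)
  next
    show "finite_measure (distr M borel (\<lambda>x. x))" "finite_measure (distr N borel (\<lambda>x. x))"
      by (rule finite_measure.finite_measure_distr[OF prob_space.finite_measure
            [OF borel_probs_prob_space] id], (rule M N)+)+
  qed simp_all
  show "sets M = sets N" using borel_probs_sets[OF M] borel_probs_sets[OF N] by simp
  fix A assume A: "A \<in> sets M"
  have borelA: "A \<in> sets borel" and AK: "A \<subseteq> K"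
    using A K by (auto simp: borel_probs_sets[OF M] sets_restrict_space)
  have "emeasure (distr P borel (\<lambda>x. x)) A = emeasure P A" if "P \<in> borel_probs K" for P :: "'b measure"
  proof -
    have "(\<lambda>x. x) -` A \<inter> space P = A" using AK borel_probs_space[OF that] by auto
    then show ?thesis using borelA by (subst emeasure_distr[OF id[OF that]]) auto
  qed
  from this[OF M] this[OF N] same show "emeasure M A = emeasure N A" by simp
qed

section \<open>Quadratic energies of nonnegative densities\<close>

text \<open>Write \<open>v = max 0 (c - p)\<close>. The difference of the two energies minus \<open>(u - v)\<^sup>2 / 2\<close> has the
  integrand \<open>(v + p) (u - v)\<close>. Where \<open>v > 0\<close>, the first factor is \<open>c\<close>; where \<open>v = 0\<close>, it is at
  least \<open>c\<close> and the second factor is nonnegative. So the integrand is at least \<open>c (u - v)\<close>, which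
  integrates to zero because the masses agree.\<close>

lemma truncated_potential_strictly_optimal:
  fixes p u :: "'b \<Rightarrow> real"
  assumes L: "finite_measure L"
    and p: "p \<in> borel_measurable L" "\<And>x. x \<in> space L \<Longrightarrow> \<bar>p x\<bar> \<le> B"
    and u: "u \<in> borel_measurable L" "\<And>x. 0 \<le> u x" "integrable L (\<lambda>x. (u x)\<^sup>2)"
    and mass: "(LINT x|L. u x) = (LINT x|L. max 0 (c - p x))"
  shows "(LINT x|L. (max 0 (c - p x))\<^sup>2) / 2 + (LINT x|L. max 0 (c - p x) * p x)
      + (LINT x|L. (u x - max 0 (c - p x))\<^sup>2) / 2
    \<le> (LINT x|L. (u x)\<^sup>2) / 2 + (LINT x|L. u x * p x)"
    and "integrable L (\<lambda>x. (u x - max 0 (c - p x))\<^sup>2)"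
proof -
  interpret finite_measure L by fact
  note [measurable] = p(1) u(1)
  define v where "v x = max 0 (c - p x)" for x
  have [measurable]: "v \<in> borel_measurable L" unfolding v_def by measurable
  define A where "A = \<bar>c\<bar> + \<bar>B\<bar>"
  have vA: "\<bar>v x\<bar> \<le> A" "\<bar>p x\<bar> \<le> A" if "x \<in> space L" for x
    using p(2)[OF that] by (auto simp: v_def A_def)
  have A0: "0 \<le> A" by (simp add: A_def)
  have iu: "integrable L u"
  proof (rule Bochner_Integration.integrable_bound)
    show "integrable L (\<lambda>x. 1 + (u x)\<^sup>2)" using u(3) by simp
    have "\<bar>u x\<bar> \<le> 1 + (u x)\<^sup>2" for x
      using sum_squares_bound[of 1 "\<bar>u x\<bar>"] by (simp add: power2_eq_square)
    then show "AE x in L. norm (u x) \<le> norm (1 + (u x)\<^sup>2)" by (simp add: add_nonneg_nonneg)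
  qed simp
  have bounded_times: "integrable L (\<lambda>x. u x * g x)"
    if [measurable]: "g \<in> borel_measurable L" and "\<And>x. x \<in> space L \<Longrightarrow> \<bar>g x\<bar> \<le> A" for g
  proof (rule Bochner_Integration.integrable_bound)
    show "integrable L (\<lambda>x. A * u x)" using iu by simp
    show "AE x in L. norm (u x * g x) \<le> norm (A * u x)"
      using that(2) u(2) A0 by (intro AE_I2) (simp add: abs_mult mult.commute[of A] mult_left_mono)
  qed simp
  have bounded: "integrable L (\<lambda>x. g x * h x)"
    if [measurable]: "g \<in> borel_measurable L" "h \<in> borel_measurable L"
      and "\<And>x. x \<in> space L \<Longrightarrow> \<bar>g x\<bar> \<le> A" "\<And>x. x \<in> space L \<Longrightarrow> \<bar>h x\<bar> \<le> A" for g h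
  proof (rule integrable_const_bound[where B = "A * A"])
    show "AE x in L. norm (g x * h x) \<le> A * A"
      using that(3,4) A0 by (intro AE_I2) (simp add: abs_mult mult_mono)
  qed simp
  have iv: "integrable L v"
    using vA by (intro integrable_const_bound[where B = A] AE_I2) auto
  note int = iu iv u(3) bounded_times[of v] bounded_times[of p] bounded[of v v] bounded[of v p]
  have iuv: "integrable L (\<lambda>x. u x * v x)" and iup: "integrable L (\<lambda>x. u x * p x)"
    and ivv: "integrable L (\<lambda>x. (v x)\<^sup>2)" and ivp: "integrable L (\<lambda>x. v x * p x)"
    using int vA by (auto simp: power2_eq_square)
  have square: "(u x - v x)\<^sup>2 = (u x)\<^sup>2 - 2 * (u x * v x) + (v x)\<^sup>2" for x
    by (simp add: power2_diff)
  show int_diff: "integrable L (\<lambda>x. (u x - max 0 (c - p x))\<^sup>2)"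
    unfolding v_def[symmetric] square using iuv ivv u(3) by simp
  have pointwise: "c * (u x - v x) \<le> ((u x)\<^sup>2 / 2 + u x * p x) - ((v x)\<^sup>2 / 2 + v x * p x) - (u x - v x)\<^sup>2 / 2" for x
  proof -
    have "c * (u x - v x) \<le> (v x + p x) * (u x - v x)"
    proof (cases "p x \<le> c")
      case True then show ?thesis by (simp add: v_def)
    next
      case False then show ?thesis using u(2)[of x] by (simp add: v_def mult_right_mono)
    qed
    also have "\<dots> = ((u x)\<^sup>2 / 2 + u x * p x) - ((v x)\<^sup>2 / 2 + v x * p x) - (u x - v x)\<^sup>2 / 2"
      by (simp add: power2_eq_square field_simps)
    finally show ?thesis .
  qed
  have "0 = (LINT x|L. c * (u x - v x))"
    using mass iu iv by (simp add: v_def[symmetric])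
  also have "\<dots> \<le> (LINT x|L. ((u x)\<^sup>2 / 2 + u x * p x) - ((v x)\<^sup>2 / 2 + v x * p x) - (u x - v x)\<^sup>2 / 2)"
    using iu iv u(3) iup ivv ivp int_diff[folded v_def] pointwise by (intro integral_mono) auto
  also have "\<dots> = ((LINT x|L. (u x)\<^sup>2) / 2 + (LINT x|L. u x * p x))
      - ((LINT x|L. (v x)\<^sup>2) / 2 + (LINT x|L. v x * p x)) - (LINT x|L. (u x - v x)\<^sup>2) / 2"
    using iu iv u(3) iup ivv ivp int_diff[folded v_def] by simp
  finally show "(LINT x|L. (max 0 (c - p x))\<^sup>2) / 2 + (LINT x|L. max 0 (c - p x) * p x)
      + (LINT x|L. (u x - max 0 (c - p x))\<^sup>2) / 2
    \<le> (LINT x|L. (u x)\<^sup>2) / 2 + (LINT x|L. u x * p x)"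
    by (simp add: v_def)
qed

text \<open>The mass is a Lipschitz function of the level \<open>c\<close> that vanishes at \<open>c = -\<bar>B\<bar>\<close> and has
  reached \<open>m\<close> at \<open>c = \<bar>B\<bar> + m / |L|\<close>, where \<open>|L|\<close> is the total measure, so the
  intermediate value theorem applies.\<close>

lemma ex_level_with_mass:
  fixes p :: "'b \<Rightarrow> real"
  assumes L: "finite_measure L" and pos: "0 < measure L (space L)"
    and p: "p \<in> borel_measurable L" "\<And>x. x \<in> space L \<Longrightarrow> \<bar>p x\<bar> \<le> B"
    and m: "0 \<le> m"
  shows "\<exists>c. (LINT x|L. max 0 (c - p x)) = m"
proof -
  interpret finite_measure L by fact
  note [measurable] = p(1)
  let ?V = "measure L (space L)"
  define I where "I c = (LINT x|L. max 0 (c - p x))" for c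
  have int: "integrable L (\<lambda>x. max 0 (c - p x))" for c
  proof (rule integrable_const_bound[where B = "\<bar>c\<bar> + \<bar>B\<bar>"])
    show "AE x in L. norm (max 0 (c - p x)) \<le> \<bar>c\<bar> + \<bar>B\<bar>"
      using p(2) by (intro AE_I2) (force simp: max_def)
  qed simp
  have "?V-lipschitz_on UNIV I"
  proof (rule lipschitz_onI)
    fix s t :: real
    have "\<bar>I s - I t\<bar> = \<bar>LINT x|L. max 0 (s - p x) - max 0 (t - p x)\<bar>"
      using int by (simp add: I_def)
    also have "\<dots> \<le> (LINT x|L. \<bar>max 0 (s - p x) - max 0 (t - p x)\<bar>)"
      by (rule integral_abs_bound)
    also have "\<dots> \<le> (LINT x|L. \<bar>s - t\<bar>)"
      using int by (intro integral_mono) (auto simp: max_def)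
    finally show "dist (I s) (I t) \<le> ?V * dist s t"
      by (simp add: dist_real_def mult.commute)
  qed simp
  then have cont: "continuous_on {-\<bar>B\<bar>..\<bar>B\<bar> + m / ?V} I"
    by (blast intro: lipschitz_on_continuous_on continuous_on_subset)
  have "I (-\<bar>B\<bar>) = (LINT x|L. 0)"
    unfolding I_def using p(2) by (intro Bochner_Integration.integral_cong refl) (force simp: max_def)
  then have lower: "I (-\<bar>B\<bar>) \<le> m" using m by simp
  have "m = (LINT x|L. m / ?V)" using pos by simp
  also have "\<dots> \<le> I (\<bar>B\<bar> + m / ?V)"
    unfolding I_def using p(2) int by (intro integral_mono) (force simp: max_def)+
  finally have upper: "m \<le> I (\<bar>B\<bar> + m / ?V)" .
  have "0 \<le> m / ?V" using m pos by simp
  then have "-\<bar>B\<bar> \<le> \<bar>B\<bar> + m / ?V" by simp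
  from IVT'[OF lower upper this cont] show ?thesis unfolding I_def by blast
qed

section \<open>The Lebesgue measure on a compact set\<close>

lemma finite_measure_restrict_lborel:
  assumes "compact (\<Omega> :: 'b::euclidean_space set)"
  shows "finite_measure (restrict_space lborel \<Omega>)"
proof (rule finite_measureI)
  show "emeasure (restrict_space lborel \<Omega>) (space (restrict_space lborel \<Omega>)) \<noteq> \<infinity>"
    using emeasure_lborel_cbox_finite emeasure_bounded_finite[OF compact_imp_bounded[OF assms]]
    by (simp add: emeasure_restrict_space space_restrict_space assms borel_compact less_top)
qed

lemma measure_restrict_lborel_pos:
  fixes \<Omega> :: "'b::euclidean_space set"
  assumes "compact \<Omega>" "interior \<Omega> \<noteq> {}"
  shows "0 < measure (restrict_space lborel \<Omega>) (space (restrict_space lborel \<Omega>))"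
proof -
  obtain a e where e: "e > 0" "ball a e \<subseteq> \<Omega>"
    using assms(2) by (auto simp: set_eq_iff mem_interior)
  have "\<Omega> \<in> fmeasurable lborel"
    using emeasure_bounded_finite[OF compact_imp_bounded[OF assms(1)]]
    by (intro fmeasurableI) (auto simp: borel_compact assms(1))
  then have "measure lborel (ball a e) \<le> measure lborel \<Omega>"
    using e(2) by (intro measure_mono_fmeasurable) auto
  moreover have "0 < measure lborel (ball a e)"
    using content_ball_pos[OF e(1), of a] by simp
  ultimately have "0 < measure lborel \<Omega>" by linarith
  then show ?thesis
    using assms(1) by (simp add: measure_restrict_space space_restrict_space borel_compact)
qed

lemma sets_restrict_lborel:
  "sets (restrict_space lborel \<Omega>) = sets (restrict_space borel \<Omega>)"
  by (intro sets_restrict_space_cong) simp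

lemma L2_norm_squared_density:
  fixes \<Omega> :: "'b::euclidean_space set"
  assumes \<Omega>: "compact \<Omega>" and v: "v \<in> borel_measurable (restrict_space lborel \<Omega>)" "\<And>x. 0 \<le> v x"
  shows "L2_norm_squared \<Omega> (density (restrict_space lborel \<Omega>) (\<lambda>x. ennreal (v x))) =
    (\<integral>\<^sup>+ x. ennreal ((v x)\<^sup>2) \<partial>restrict_space lborel \<Omega>)"
proof -
  let ?L = "restrict_space lborel \<Omega>"
  interpret finite_measure ?L by (rule finite_measure_restrict_lborel[OF \<Omega>])
  have [measurable]: "(\<lambda>x. ennreal (v x)) \<in> borel_measurable ?L" using v(1) by simp
  have "AE x in ?L. ennreal (v x) = RN_deriv ?L (density ?L (\<lambda>x. ennreal (v x))) x"
    by (rule RN_deriv_unique) simp_all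
  then have "AE x in ?L. (RN_deriv ?L (density ?L (\<lambda>x. ennreal (v x))) x)\<^sup>2 = ennreal ((v x)\<^sup>2)"
    by eventually_elim (metis ennreal_power v(2))
  then have "(\<integral>\<^sup>+ x. (RN_deriv ?L (density ?L (\<lambda>x. ennreal (v x))) x)\<^sup>2 \<partial>?L) =
      (\<integral>\<^sup>+ x. ennreal ((v x)\<^sup>2) \<partial>?L)"
    by (rule nn_integral_cong_AE)
  moreover have "absolutely_continuous ?L (density ?L (\<lambda>x. ennreal (v x)))"
    by (rule absolutely_continuousI_density) simp
  ultimately show ?thesis by (simp add: L2_norm_squared_def Let_def)
qed

lemma L2_norm_squared_finiteE:
  fixes \<Omega> :: "'b::euclidean_space set"
  assumes \<Omega>: "compact \<Omega>" and \<mu>: "\<mu> \<in> borel_probs \<Omega>" and fin: "L2_norm_squared \<Omega> \<mu> < \<infinity>"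
  obtains u where "u \<in> borel_measurable (restrict_space lborel \<Omega>)" "\<And>x. 0 \<le> u x"
    "\<mu> = density (restrict_space lborel \<Omega>) (\<lambda>x. ennreal (u x))"
    "integrable (restrict_space lborel \<Omega>) (\<lambda>x. (u x)\<^sup>2)"
    "L2_norm_squared \<Omega> \<mu> = ennreal (LINT x|restrict_space lborel \<Omega>. (u x)\<^sup>2)"
proof
  let ?L = "restrict_space lborel \<Omega>"
  interpret finite_measure ?L by (rule finite_measure_restrict_lborel[OF \<Omega>])
  interpret \<mu>: prob_space \<mu> by (rule borel_probs_prob_space[OF \<mu>])
  define u where "u x = enn2real (RN_deriv ?L \<mu> x)" for x
  have ac: "absolutely_continuous ?L \<mu>"
    using fin by (auto simp: L2_norm_squared_def Let_def split: if_splits)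
  have sets: "sets \<mu> = sets ?L"
    by (simp add: sets_restrict_lborel borel_probs_sets[OF \<mu>])
  show meas[measurable]: "u \<in> borel_measurable ?L" unfolding u_def by measurable
  show u0: "0 \<le> u x" for x by (simp add: u_def)
  have AE_u: "AE x in ?L. RN_deriv ?L \<mu> x = ennreal (u x)"
    using RN_deriv_finite[OF \<mu>.sigma_finite_measure_axioms ac sets]
    by eventually_elim (simp add: u_def less_top)
  have "\<mu> = density ?L (RN_deriv ?L \<mu>)" using density_RN_deriv[OF ac sets] by simp
  also have "\<dots> = density ?L (\<lambda>x. ennreal (u x))"
    using AE_u by (intro density_cong) auto
  finally show dens: "\<mu> = density ?L (\<lambda>x. ennreal (u x))" .
  then have eq: "L2_norm_squared \<Omega> \<mu> = (\<integral>\<^sup>+ x. ennreal ((u x)\<^sup>2) \<partial>?L)"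
    using L2_norm_squared_density[OF \<Omega> meas u0] by simp
  show int: "integrable ?L (\<lambda>x. (u x)\<^sup>2)"
    using fin eq by (intro integrableI_bounded) auto
  show "L2_norm_squared \<Omega> \<mu> = ennreal (LINT x|?L. (u x)\<^sup>2)"
    unfolding eq by (intro nn_integral_eq_integral int) simp
qed

section \<open>Transport towards a contracted image\<close>

definition homothety :: "'b::real_vector \<Rightarrow> real \<Rightarrow> 'b \<Rightarrow> 'b"
  where "homothety a c x = a + c *\<^sub>R (x - a)"

lemma continuous_on_homothety: "continuous_on S (homothety (a::'b::real_normed_vector) c)"
  unfolding homothety_def by (intro continuous_intros)

lemma homothety_image_subset_convex:
  assumes "convex K" "a \<in> K" "0 \<le> c" "c \<le> 1"
  shows "homothety a c ` K \<subseteq> K"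
proof safe
  fix x assume "x \<in> K"
  then have "(1 - c) *\<^sub>R a + c *\<^sub>R x \<in> K" using assms by (intro convexD) auto
  also have "(1 - c) *\<^sub>R a + c *\<^sub>R x = homothety a c x"
    by (simp add: homothety_def algebra_simps)
  finally show "homothety a c x \<in> K" .
qed

text \<open>For fixed \<open>x\<close> the left side is a quadratic function of \<open>y\<close> with minimizer the image of \<open>x\<close>
  under the homothety; the right side is its expansion about that point.\<close>

lemma quadratic_cost_complete_square:
  fixes x y a :: "'b::real_inner"
  assumes l: "l > 0"
  shows "(norm (x - y))\<^sup>2 / 2 + l * (norm (y - a))\<^sup>2 =
    l / (2 * l + 1) * (norm (x - a))\<^sup>2
    + (2 * l + 1) / 2 * (norm (y - homothety a (1 / (2 * l + 1)) x))\<^sup>2"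
proof -
  define X Y c where "X = x - a" and "Y = y - a" and "c = 1 / (2 * l + 1)"
  have xy: "x - y = X - Y" "y - homothety a c x = Y - c *\<^sub>R X"
    by (simp_all add: X_def Y_def homothety_def)
  have exp: "(norm (X - Y))\<^sup>2 = inner X X - 2 * inner X Y + inner Y Y"
    "(norm (Y - c *\<^sub>R X))\<^sup>2 = inner Y Y - 2 * c * inner X Y + c\<^sup>2 * inner X X"
    "(norm X)\<^sup>2 = inner X X" "(norm Y)\<^sup>2 = inner Y Y"
    unfolding power2_norm_eq_inner
    by (simp_all add: inner_diff_left inner_diff_right inner_commute power2_eq_square algebra_simps)
  have "(2 * l + 1) * c = 1" "l / (2 * l + 1) = l * c" using l by (simp_all add: c_def)
  then have "(norm (X - Y))\<^sup>2 / 2 + l * (norm Y)\<^sup>2 =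
      l / (2 * l + 1) * (norm X)\<^sup>2 + (2 * l + 1) / 2 * (norm (Y - c *\<^sub>R X))\<^sup>2"
    unfolding exp by algebra
  then show ?thesis unfolding c_def[symmetric] xy X_def[symmetric] Y_def[symmetric] .
qed

lemma transport_plansD:
  assumes "\<gamma> \<in> transport_plans \<Omega> \<mu> \<nu>"
  shows "\<gamma> \<in> borel_probs (\<Omega> \<times> \<Omega>)" "distr \<gamma> (restrict_space borel \<Omega>) fst = \<mu>"
    "distr \<gamma> (restrict_space borel \<Omega>) snd = \<nu>"
  using assms by (auto simp: transport_plans_def)

lemma
  fixes \<gamma> :: "('b::euclidean_space \<times> 'b) measure" and f :: "'b \<Rightarrow> real"
  assumes \<gamma>: "\<gamma> \<in> transport_plans \<Omega> \<mu> \<nu>" and f: "continuous_on UNIV f"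
  shows integral_transport_plan_fst: "(LINT x|\<mu>. f x) = (LINT z|\<gamma>. f (fst z))"
    and integral_transport_plan_snd: "(LINT y|\<nu>. f y) = (LINT z|\<gamma>. f (snd z))"
proof -
  note D = transport_plansD[OF \<gamma>]
  have f': "f \<in> borel_measurable (restrict_space borel \<Omega>)"
    by (intro measurable_restrict_space1 borel_measurable_continuous_onI f)
  have "fst \<in> measurable \<gamma> (restrict_space borel \<Omega>)" "snd \<in> measurable \<gamma> (restrict_space borel \<Omega>)"
    by (intro borel_probs_measurable_restrict[OF D(1)] borel_measurable_continuous_onI continuous_intros; force)+
  then show "(LINT x|\<mu>. f x) = (LINT z|\<gamma>. f (fst z))" "(LINT y|\<nu>. f y) = (LINT z|\<gamma>. f (snd z))"
    using f' by (simp_all add: integral_distr flip: D(2,3))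
qed

lemma transport_plan_cost_decomposition:
  fixes \<gamma> :: "('b::euclidean_space \<times> 'b) measure"
  assumes \<gamma>: "\<gamma> \<in> transport_plans \<Omega> \<mu> \<nu>" and \<Omega>: "compact \<Omega>" and l: "l > 0"
  shows "(LINT z|\<gamma>. (norm (fst z - snd z))\<^sup>2) / 2 + l * (LINT y|\<nu>. (norm (y - a))\<^sup>2) =
    l / (2 * l + 1) * (LINT x|\<mu>. (norm (x - a))\<^sup>2)
    + (2 * l + 1) / 2 * (LINT z|\<gamma>. (norm (snd z - homothety a (1 / (2 * l + 1)) (fst z)))\<^sup>2)"
proof -
  note int = integrable_continuous_borel_probs[OF transport_plansD(1)[OF \<gamma>] compact_Times[OF \<Omega> \<Omega>]]
  have ints: "integrable \<gamma> (\<lambda>z. (norm (fst z - snd z))\<^sup>2)" "integrable \<gamma> (\<lambda>z. (norm (snd z - a))\<^sup>2)"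
    "integrable \<gamma> (\<lambda>z. (norm (fst z - a))\<^sup>2)"
    "integrable \<gamma> (\<lambda>z. (norm (snd z - homothety a (1 / (2 * l + 1)) (fst z)))\<^sup>2)"
    unfolding homothety_def by (intro int continuous_intros)+
  have "(LINT z|\<gamma>. (norm (fst z - snd z))\<^sup>2) / 2 + l * (LINT z|\<gamma>. (norm (snd z - a))\<^sup>2) =
      (LINT z|\<gamma>. (norm (fst z - snd z))\<^sup>2 / 2 + l * (norm (snd z - a))\<^sup>2)"
    using ints by simp
  also have "\<dots> = l / (2 * l + 1) * (LINT z|\<gamma>. (norm (fst z - a))\<^sup>2)
    + (2 * l + 1) / 2 * (LINT z|\<gamma>. (norm (snd z - homothety a (1 / (2 * l + 1)) (fst z)))\<^sup>2)"
    unfolding quadratic_cost_complete_square[OF l] using ints by simp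
  finally show ?thesis
    by (subst integral_transport_plan_fst[OF \<gamma>] integral_transport_plan_snd[OF \<gamma>],
        intro continuous_intros)+
qed

text \<open>For a \<open>C\<close>-Lipschitz \<open>f\<close> the integrals against \<open>\<nu>\<close> and the image of \<open>\<mu>\<close> differ by at most
  \<open>C\<close> times \<open>\<integral> |y - T x| d\<gamma>\<close>, and \<open>t \<le> e + t\<^sup>2 / e\<close> bounds this first moment by the assumed
  second moment.\<close>

lemma distr_eqI_transport_plans:
  fixes \<mu> \<nu> :: "'b::euclidean_space measure"
  assumes \<Omega>: "compact \<Omega>" and \<mu>: "\<mu> \<in> borel_probs \<Omega>" and \<nu>: "\<nu> \<in> borel_probs \<Omega>"
    and T: "continuous_on UNIV T" "T ` \<Omega> \<subseteq> \<Omega>"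
    and close: "\<And>e. e > 0 \<Longrightarrow> \<exists>\<gamma>\<in>transport_plans \<Omega> \<mu> \<nu>. (LINT z|\<gamma>. (norm (snd z - T (fst z)))\<^sup>2) \<le> e"
  shows "\<nu> = distr \<mu> (restrict_space borel \<Omega>) T"
proof (rule borel_probs_eqI_lipschitz[OF \<nu> _ compact_imp_closed[OF \<Omega>]])
  have Tm: "T \<in> borel_measurable borel" by (intro borel_measurable_continuous_onI T)
  show "distr \<mu> (restrict_space borel \<Omega>) T \<in> borel_probs \<Omega>"
    by (rule borel_probs_distr[OF \<mu> Tm T(2)])
  fix f :: "'b \<Rightarrow> real" and C
  assume lip: "C-lipschitz_on UNIV f"
  then have C: "0 \<le> C" and f: "continuous_on UNIV f"
    by (auto intro: lipschitz_on_continuous_on lipschitz_on_nonneg)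
  have fT: "continuous_on UNIV (\<lambda>x. f (T x))"
    using continuous_on_compose2[OF f T(1)] by simp
  have bound: "\<bar>(LINT x|\<nu>. f x) - (LINT x|\<mu>. f (T x))\<bar> \<le> 0 + d" if d: "d > 0" for d
  proof -
    \<comment> \<open>The first moment will be at most \<open>2 e\<close>; adding one in the denominator covers \<open>C = 0\<close>.\<close>
    define e where "e = d / (2 * C + 1)"
    have e: "e > 0" "C * (2 * e) \<le> d" using d C by (auto simp: e_def field_simps)
    obtain \<gamma> where \<gamma>: "\<gamma> \<in> transport_plans \<Omega> \<mu> \<nu>"
      and J: "(LINT z|\<gamma>. (norm (snd z - T (fst z)))\<^sup>2) \<le> e\<^sup>2"
      using close[of "e\<^sup>2"] e by auto
    interpret prob_space \<gamma> by (rule borel_probs_prob_space[OF transport_plansD(1)[OF \<gamma>]])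
    note int = integrable_continuous_borel_probs[OF transport_plansD(1)[OF \<gamma>] compact_Times[OF \<Omega> \<Omega>]]
    have ints: "integrable \<gamma> (\<lambda>z. (norm (snd z - T (fst z)))\<^sup>2)" "integrable \<gamma> (\<lambda>z. f (snd z))"
      "integrable \<gamma> (\<lambda>z. f (T (fst z)))"
      by (intro int continuous_intros continuous_on_compose2[OF T(1)] continuous_on_compose2[OF f]; simp)+
    have "(LINT x|\<nu>. f x) - (LINT x|\<mu>. f (T x)) = (LINT z|\<gamma>. f (snd z) - f (T (fst z)))"
      using ints by (simp add: integral_transport_plan_snd[OF \<gamma> f] integral_transport_plan_fst[OF \<gamma> fT])
    also have "\<bar>\<dots>\<bar> \<le> (LINT z|\<gamma>. \<bar>f (snd z) - f (T (fst z))\<bar>)"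
      by (rule integral_abs_bound)
    also have "\<dots> \<le> (LINT z|\<gamma>. C * (e + (norm (snd z - T (fst z)))\<^sup>2 / e))"
    proof (rule integral_mono)
      fix z
      let ?t = "norm (snd z - T (fst z))"
      have "?t \<le> e + ?t\<^sup>2 / e"
      proof (cases "?t \<le> e")
        case False
        then have "?t * e \<le> ?t\<^sup>2" by (simp add: power2_eq_square mult_left_mono)
        then show ?thesis using e by (simp add: field_simps add_increasing)
      qed (use e in \<open>simp add: add_increasing2\<close>)
      then have "C * ?t \<le> C * (e + ?t\<^sup>2 / e)" using C by (rule mult_left_mono)
      moreover have "\<bar>f (snd z) - f (T (fst z))\<bar> \<le> C * ?t"
        using lipschitz_onD[OF lip, of "snd z" "T (fst z)"] by (simp add: dist_norm)
      ultimately show "\<bar>f (snd z) - f (T (fst z))\<bar> \<le> C * (e + ?t\<^sup>2 / e)" by linarith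
    qed (use ints in simp_all)
    also have "\<dots> = C * (e + (LINT z|\<gamma>. (norm (snd z - T (fst z)))\<^sup>2) / e)"
      using ints by (simp add: prob_space)
    also have "\<dots> \<le> C * (e + e\<^sup>2 / e)"
      using J C e by (intro mult_left_mono add_left_mono divide_right_mono) auto
    also have "\<dots> \<le> 0 + d" using e by (simp add: power2_eq_square)
    finally show ?thesis .
  qed
  then have "\<bar>(LINT x|\<nu>. f x) - (LINT x|\<mu>. f (T x))\<bar> \<le> 0" by (rule field_le_epsilon)
  moreover have "(LINT x|distr \<mu> (restrict_space borel \<Omega>) T. f x) = (LINT x|\<mu>. f (T x))"
    by (intro integral_distr borel_probs_measurable_restrict[OF \<mu> Tm T(2)]
        measurable_restrict_space1 borel_measurable_continuous_onI f)
  ultimately show "(LINT x|\<nu>. f x) = (LINT x|distr \<mu> (restrict_space borel \<Omega>) T. f x)" by simp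
qed

text \<open>The plan induced by the homothety annihilates the square in the decomposition of the transport
  cost. Only an inequality holds, because \<open>a\<close> need not be the barycenter of the image.\<close>

lemma functional_F_homothety_le:
  fixes \<Omega> :: "'b::euclidean_space set"
  assumes \<Omega>: "compact \<Omega>" "convex \<Omega>" and l: "l > 0" and a: "a \<in> \<Omega>" and \<mu>: "\<mu> \<in> borel_probs \<Omega>"
  shows "functional_F \<Omega> l \<mu> (distr \<mu> (restrict_space borel \<Omega>) (homothety a (1 / (2 * l + 1))))
    \<le> L2_norm_squared \<Omega> \<mu> / 2 + ennreal (l / (2 * l + 1) * (LINT x|\<mu>. (norm (x - a))\<^sup>2))"
proof -
  let ?B = "restrict_space borel \<Omega>" and ?B2 = "restrict_space borel (\<Omega> \<times> \<Omega>)"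
  define T where "T = homothety a (1 / (2 * l + 1))"
  have T_into: "T ` \<Omega> \<subseteq> \<Omega>"
    unfolding T_def using l by (intro homothety_image_subset_convex \<Omega>(2) a) auto
  have T_cont: "continuous_on S T" for S
    unfolding T_def by (rule continuous_on_homothety)
  have T_meas: "T \<in> borel_measurable borel"
    by (intro borel_measurable_continuous_onI T_cont)
  let ?\<nu> = "distr \<mu> ?B T"
  have \<nu>: "?\<nu> \<in> borel_probs \<Omega>" by (rule borel_probs_distr[OF \<mu> T_meas T_into])
  define \<gamma> where "\<gamma> = distr \<mu> ?B2 (\<lambda>x. (x, T x))"
  have pair: "(\<lambda>x. (x, T x)) \<in> borel_measurable borel" "(\<lambda>x. (x, T x)) ` \<Omega> \<subseteq> \<Omega> \<times> \<Omega>"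
    using T_into by (auto intro!: borel_measurable_continuous_onI continuous_intros T_cont)
  have pairm: "(\<lambda>x. (x, T x)) \<in> measurable \<mu> ?B2"
    by (rule borel_probs_measurable_restrict[OF \<mu> pair])
  have proj: "fst \<in> measurable ?B2 ?B" "snd \<in> measurable ?B2 ?B"
    by (intro measurable_restrict_space3 borel_measurable_continuous_onI continuous_intros; force)+
  have \<gamma>: "\<gamma> \<in> transport_plans \<Omega> \<mu> ?\<nu>"
    using borel_probs_distr[OF \<mu> pair] borel_probs_sets[OF \<mu>]
    by (simp add: transport_plans_def \<gamma>_def distr_distr[OF proj(1) pairm]
        distr_distr[OF proj(2) pairm] comp_def distr_id2)
  have "W2_squared \<Omega> \<mu> ?\<nu> \<le> (\<integral>\<^sup>+ (x, y). ennreal ((norm (x - y))\<^sup>2) \<partial>\<gamma>)"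
    unfolding W2_squared_def by (rule INF_lower[OF \<gamma>])
  also have "\<dots> = (\<integral>\<^sup>+ z. ennreal ((norm (fst z - snd z))\<^sup>2) \<partial>\<gamma>)"
    by (simp only: case_prod_beta')
  also have "\<dots> = ennreal (LINT z|\<gamma>. (norm (fst z - snd z))\<^sup>2)"
    by (intro nn_integral_continuous_borel_probs[OF transport_plansD(1)[OF \<gamma>]]
        compact_Times \<Omega> continuous_intros) simp
  finally have "W2_squared \<Omega> \<mu> ?\<nu> / 2 \<le> ennreal ((LINT z|\<gamma>. (norm (fst z - snd z))\<^sup>2) / 2)"
    by (simp add: ennreal_divide_numeral[symmetric] divide_right_mono_ennreal)
  moreover have "(\<integral>\<^sup>+ (x, y). ennreal (l / 2 * (norm (x - y))\<^sup>2) \<partial>(?\<nu> \<Otimes>\<^sub>M ?\<nu>))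
      \<le> ennreal (l * (LINT y|?\<nu>. (norm (y - a))\<^sup>2))"
    unfolding interaction_energy_eq[OF \<nu> \<Omega>(1) less_imp_le[OF l], of a]
    using l by (intro ennreal_leI mult_left_mono) auto
  ultimately have "functional_F \<Omega> l \<mu> ?\<nu> \<le>
      ennreal ((LINT z|\<gamma>. (norm (fst z - snd z))\<^sup>2) / 2) + L2_norm_squared \<Omega> \<mu> / 2
      + ennreal (l * (LINT y|?\<nu>. (norm (y - a))\<^sup>2))"
    unfolding functional_F_def by (intro add_mono order_refl)
  also have "\<dots> = L2_norm_squared \<Omega> \<mu> / 2 + ennreal ((LINT z|\<gamma>. (norm (fst z - snd z))\<^sup>2) / 2
      + l * (LINT y|?\<nu>. (norm (y - a))\<^sup>2))"
    using l by (simp add: ac_simps)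
  also have "(LINT z|\<gamma>. (norm (fst z - snd z))\<^sup>2) / 2 + l * (LINT y|?\<nu>. (norm (y - a))\<^sup>2) =
      l / (2 * l + 1) * (LINT x|\<mu>. (norm (x - a))\<^sup>2)"
  proof -
    have "(LINT z|\<gamma>. (norm (snd z - T (fst z)))\<^sup>2) = (LINT x|\<mu>. (norm (T x - T x))\<^sup>2)"
      unfolding \<gamma>_def
      by (subst integral_distr[OF pairm])
        (auto intro!: measurable_restrict_space1 borel_measurable_continuous_onI continuous_intros
          continuous_on_compose2[OF T_cont])
    then show ?thesis
      using transport_plan_cost_decomposition[OF \<gamma> \<Omega>(1) l, of a] by (simp add: T_def)
  qed
  finally show ?thesis unfolding T_def .
qed

text \<open>The infimum in the Wasserstein term is approached up to \<open>2 e\<close> by some plan, to which the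
  decomposition of the cost about the barycenter applies; there the interaction energy is exactly
  \<open>l\<close> times the second moment.\<close>

lemma ex_near_optimal_plan:
  fixes \<Omega> :: "'b::euclidean_space set"
  assumes \<Omega>: "compact \<Omega>" and l: "l > 0" and \<mu>: "\<mu> \<in> borel_probs \<Omega>" and \<nu>: "\<nu> \<in> borel_probs \<Omega>"
    and q: "L2_norm_squared \<Omega> \<mu> = ennreal q" "0 \<le> q"
    and F: "functional_F \<Omega> l \<mu> \<nu> \<le> ennreal G" and e: "e > 0" and G: "0 \<le> G"
  defines "b \<equiv> LINT y|\<nu>. y"
  shows "\<exists>\<gamma>\<in>transport_plans \<Omega> \<mu> \<nu>. q / 2 + l / (2 * l + 1) * (LINT x|\<mu>. (norm (x - b))\<^sup>2)
    + (2 * l + 1) / 2 * (LINT z|\<gamma>. (norm (snd z - homothety b (1 / (2 * l + 1)) (fst z)))\<^sup>2) \<le> G + e"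
proof -
  let ?V = "LINT y|\<nu>. (norm (y - b))\<^sup>2"
  have V: "0 \<le> ?V" by (intro integral_nonneg_AE) auto
  have "(\<integral>\<^sup>+ (x, y). ennreal (l / 2 * (norm (x - y))\<^sup>2) \<partial>(\<nu> \<Otimes>\<^sub>M \<nu>)) = ennreal (l * ?V)"
    using interaction_energy_eq[OF \<nu> \<Omega> less_imp_le[OF l], of b] by (simp add: b_def)
  then have bound: "W2_squared \<Omega> \<mu> \<nu> / 2 + ennreal (q / 2) + ennreal (l * ?V) \<le> ennreal G"
    using F q by (simp add: functional_F_def ennreal_divide_numeral)
  obtain w where w: "W2_squared \<Omega> \<mu> \<nu> = ennreal w" "0 \<le> w"
    using bound by (cases "W2_squared \<Omega> \<mu> \<nu>") (auto simp: ennreal_top_divide top_unique)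
  have real_bound: "w / 2 + q / 2 + l * ?V \<le> G"
    using bound w q(2) V l G
    by (simp add: ennreal_divide_numeral flip: ennreal_plus)
  have "W2_squared \<Omega> \<mu> \<nu> < ennreal (w + 2 * e)"
    using w e by (simp add: ennreal_less_iff)
  then obtain \<gamma> where \<gamma>: "\<gamma> \<in> transport_plans \<Omega> \<mu> \<nu>"
    and less: "(\<integral>\<^sup>+ (x, y). ennreal ((norm (x - y))\<^sup>2) \<partial>\<gamma>) < ennreal (w + 2 * e)"
    by (auto simp: W2_squared_def INF_less_iff)
  have "(\<integral>\<^sup>+ (x, y). ennreal ((norm (x - y))\<^sup>2) \<partial>\<gamma>) = (\<integral>\<^sup>+ z. ennreal ((norm (fst z - snd z))\<^sup>2) \<partial>\<gamma>)"
    by (simp only: case_prod_beta')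
  also have "\<dots> = ennreal (LINT z|\<gamma>. (norm (fst z - snd z))\<^sup>2)"
    by (intro nn_integral_continuous_borel_probs[OF transport_plansD(1)[OF \<gamma>]]
        compact_Times \<Omega> continuous_intros) simp
  finally have "ennreal (LINT z|\<gamma>. (norm (fst z - snd z))\<^sup>2) < ennreal (w + 2 * e)"
    using less by (simp only:)
  moreover have "0 \<le> (LINT z|\<gamma>. (norm (fst z - snd z))\<^sup>2)" by (intro integral_nonneg_AE) auto
  ultimately have "(LINT z|\<gamma>. (norm (fst z - snd z))\<^sup>2) < w + 2 * e"
    by (simp only: ennreal_less_iff)
  then have "q / 2 + ((LINT z|\<gamma>. (norm (fst z - snd z))\<^sup>2) / 2 + l * ?V) \<le> G + e"
    using real_bound by linarith
  then show ?thesis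
    unfolding transport_plan_cost_decomposition[OF \<gamma> \<Omega> l] using \<gamma> by (auto simp: add.assoc)
qed

section \<open>The minimizers\<close>

theorem theorem4p1:
  fixes \<Omega> :: "'a::euclidean_space set" and l :: real and \<mu> \<nu> :: "'a measure"
  assumes "compact \<Omega>" and "convex \<Omega>" and "interior \<Omega> \<noteq> {}" and "l > 0"
    and "\<mu> \<in> borel_probs \<Omega>" and "\<nu> \<in> borel_probs \<Omega>"
    and "\<forall>\<mu>'\<in>borel_probs \<Omega>. \<forall>\<nu>'\<in>borel_probs \<Omega>.
           functional_F \<Omega> l \<mu> \<nu> \<le> functional_F \<Omega> l \<mu>' \<nu>'"
  shows "\<exists>(x0::'a) (r::real). r > 0 \<and>
    ((AE x in \<mu>. x \<in> ball x0 r \<inter> \<Omega>) \<and>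
     \<mu> = density (restrict_space lborel \<Omega>)
           (\<lambda>x. ennreal (l / (2 * l + 1) * (r\<^sup>2 - (norm (x - x0))\<^sup>2)) * indicator (ball x0 r) x)) \<and>
    ((AE y in \<nu>. y \<in> ball x0 (r / (2 * l + 1))) \<and>
     \<nu> = distr \<mu> (restrict_space borel \<Omega>) (\<lambda>x. x0 + (1 / (2 * l + 1)) *\<^sub>R (x - x0))) \<and>
    x0 = (LINT y|\<nu>. y)"
proof -
  note \<Omega> = assms(1,2) and l = assms(4) and \<mu> = assms(5) and \<nu> = assms(6)
  let ?L = "restrict_space lborel \<Omega>" and ?B = "restrict_space borel \<Omega>"
  define b where "b = (LINT y|\<nu>. y)"
  define k where "k = l / (2 * l + 1)"
  define T where "T = homothety b (1 / (2 * l + 1))"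
  define p where "p x = k * (norm (x - b))\<^sup>2" for x
  have k: "k > 0" using l by (simp add: k_def)
  have b: "b \<in> \<Omega>" unfolding b_def by (rule barycenter_in_convex[OF \<nu> \<Omega>])
  have T_cont: "continuous_on S T" for S unfolding T_def by (rule continuous_on_homothety)
  have T_meas: "T \<in> borel_measurable borel" by (intro borel_measurable_continuous_onI T_cont)
  have T_into: "T ` \<Omega> \<subseteq> \<Omega>"
    unfolding T_def using l by (intro homothety_image_subset_convex \<Omega>(2) b) auto
  interpret L: finite_measure ?L by (rule finite_measure_restrict_lborel[OF \<Omega>(1)])
  interpret \<mu>: prob_space \<mu> by (rule borel_probs_prob_space[OF \<mu>])
  have measL: "f \<in> borel_measurable ?L" if "continuous_on UNIV f" for f :: "'a \<Rightarrow> real"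
    using borel_measurable_continuous_onI[OF that] by (intro measurable_restrict_space1) simp
  have p_meas[measurable]: "p \<in> borel_measurable ?L"
    unfolding p_def by (intro measL continuous_intros)
  have norm_meas[measurable]: "(\<lambda>x. (norm (x - b))\<^sup>2) \<in> borel_measurable ?L"
    by (intro measL continuous_intros)
  have "compact (p ` \<Omega>)"
    unfolding p_def by (intro compact_continuous_image continuous_intros \<Omega>)
  then obtain B where B: "\<bar>p x\<bar> \<le> B" if "x \<in> space ?L" for x
    using compact_imp_bounded bounded_iff[of "p ` \<Omega>"] by (auto simp: space_restrict_space)
  obtain c where c: "(LINT x|?L. max 0 (c - p x)) = 1"
    using ex_level_with_mass[OF L.finite_measure_axioms measure_restrict_lborel_pos[OF assms(1,3)]
        p_meas B, of 1] by auto
  define v where "v x = max 0 (c - p x)" for x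
  have mass_v: "(LINT x|?L. v x) = 1" unfolding v_def by (rule c)
  have v_meas[measurable]: "v \<in> borel_measurable ?L" unfolding v_def by measurable
  have v0: "0 \<le> v x" for x by (simp add: v_def)
  \<comment> \<open>At a level \<open>c \<le> 0\<close> the truncation would vanish identically, contradicting mass one.\<close>
  have c_pos: "c > 0"
  proof (rule ccontr)
    assume "\<not> c > 0"
    moreover have "0 \<le> p x" for x using k by (simp add: p_def)
    ultimately have "c - p x \<le> 0" for x by (smt (verit))
    then have "v x = 0" for x unfolding v_def by (rule max_absorb1)
    then show False using mass_v by simp
  qed
  define r where "r = sqrt (c / k)"
  have r: "r > 0" "k * r\<^sup>2 = c" using c_pos k by (simp_all add: r_def)
  have v_pos_iff: "0 < v x \<longleftrightarrow> x \<in> ball b r" for x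
  proof -
    have "0 < v x \<longleftrightarrow> k * (norm (x - b))\<^sup>2 < k * r\<^sup>2" by (simp add: v_def p_def r(2) less_max_iff_disj)
    also have "\<dots> \<longleftrightarrow> norm (x - b) < r"
      using k r(1) abs_le_square_iff[of r "norm (x - b)"] by (simp flip: not_le)
    finally show ?thesis by (simp add: dist_norm norm_minus_commute)
  qed
  \<comment> \<open>Outside the ball both sides are zero: the indicator on the left, the truncation on the right.\<close>
  have v_eq: "ennreal (l / (2 * l + 1) * (r\<^sup>2 - (norm (x - b))\<^sup>2)) * indicator (ball b r) x = ennreal (v x)" for x
  proof -
    have "l / (2 * l + 1) * (r\<^sup>2 - (norm (x - b))\<^sup>2) = c - p x"
      by (simp add: p_def r(2)[symmetric] right_diff_distrib flip: k_def)
    then show ?thesis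
      using v_pos_iff[of x] by (cases "x \<in> ball b r") (auto simp: v_def max_def split: if_splits)
  qed

  have v_bdd: "\<bar>v x\<bar> \<le> \<bar>c\<bar> + \<bar>B\<bar>" if "x \<in> space ?L" for x
    using B[OF that] by (auto simp: v_def)
  have int_v: "integrable ?L v"
    using v_bdd by (intro L.integrable_const_bound[where B = "\<bar>c\<bar> + \<bar>B\<bar>"] AE_I2) auto
  have int_v2: "integrable ?L (\<lambda>x. (v x)\<^sup>2)"
    using v_bdd by (intro L.integrable_const_bound[where B = "(\<bar>c\<bar> + \<bar>B\<bar>)\<^sup>2"] AE_I2)
      (auto simp: abs_le_square_iff[symmetric])
  define \<mu>0 where "\<mu>0 = density ?L (\<lambda>x. ennreal (v x))"
  have "emeasure \<mu>0 (space \<mu>0) = (\<integral>\<^sup>+x. ennreal (v x) \<partial>?L)"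
    by (simp add: \<mu>0_def emeasure_density cong: nn_integral_cong)
  also have "\<dots> = 1"
    using mass_v int_v v0 by (subst nn_integral_eq_integral) auto
  finally have \<mu>0: "\<mu>0 \<in> borel_probs \<Omega>"
    by (intro borel_probsI prob_spaceI) (simp_all add: \<mu>0_def sets_restrict_lborel)

  \<comment> \<open>\<open>G\<close> is the energy of the candidate density \<open>v\<close>; it bounds the minimum from above.\<close>
  define G where "G = (LINT x|?L. (v x)\<^sup>2) / 2 + (LINT x|?L. v x * p x)"
  have G_nonneg: "0 \<le> (LINT x|?L. (v x)\<^sup>2)" "0 \<le> (LINT x|?L. v x * p x)"
    using v0 k by (auto intro!: integral_nonneg_AE simp: p_def)
  have weighted: "k * (LINT x|density ?L (\<lambda>x. ennreal (f x)). (norm (x - b))\<^sup>2) = (LINT x|?L. f x * p x)"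
    if [measurable]: "f \<in> borel_measurable ?L" and "\<And>x. 0 \<le> f x" for f
  proof -
    have "(LINT x|density ?L (\<lambda>x. ennreal (f x)). (norm (x - b))\<^sup>2) = (LINT x|?L. f x * (norm (x - b))\<^sup>2)"
      using that by (subst integral_density) auto
    then have "k * (LINT x|density ?L (\<lambda>x. ennreal (f x)). (norm (x - b))\<^sup>2)
        = (LINT x|?L. k * (f x * (norm (x - b))\<^sup>2))" by simp
    then show ?thesis by (simp add: p_def ac_simps)
  qed
  have "functional_F \<Omega> l \<mu> \<nu> \<le> functional_F \<Omega> l \<mu>0 (distr \<mu>0 ?B T)"
    using assms(7) \<mu>0 borel_probs_distr[OF \<mu>0 T_meas T_into] by blast
  also have "\<dots> \<le> L2_norm_squared \<Omega> \<mu>0 / 2 + ennreal (k * (LINT x|\<mu>0. (norm (x - b))\<^sup>2))"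
    unfolding T_def k_def by (rule functional_F_homothety_le[OF \<Omega> l b \<mu>0])
  also have "L2_norm_squared \<Omega> \<mu>0 = ennreal (LINT x|?L. (v x)\<^sup>2)"
    unfolding \<mu>0_def L2_norm_squared_density[OF \<Omega>(1) v_meas v0]
    by (intro nn_integral_eq_integral int_v2) simp
  also have "ennreal (LINT x|?L. (v x)\<^sup>2) / 2 + ennreal (k * (LINT x|\<mu>0. (norm (x - b))\<^sup>2)) = ennreal G"
    unfolding \<mu>0_def weighted[OF v_meas v0] G_def using G_nonneg
    by (simp add: ennreal_divide_numeral flip: ennreal_plus)
  finally have F_le: "functional_F \<Omega> l \<mu> \<nu> \<le> ennreal G" .
  have "L2_norm_squared \<Omega> \<mu> / 2 \<le> functional_F \<Omega> l \<mu> \<nu>"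
    by (simp add: functional_F_def add.assoc add_increasing add_increasing2)
  also note F_le
  also have "ennreal G < \<infinity>" by simp
  finally have "L2_norm_squared \<Omega> \<mu> / 2 < \<infinity>" .
  then have "L2_norm_squared \<Omega> \<mu> < \<infinity>"
    by (cases "L2_norm_squared \<Omega> \<mu>") (auto simp: ennreal_top_divide)
  from L2_norm_squared_finiteE[OF \<Omega>(1) \<mu> this] obtain u where
    u_meas[measurable]: "u \<in> borel_measurable ?L" and u0: "\<And>x. 0 \<le> u x"
    and \<mu>_u: "\<mu> = density ?L (\<lambda>x. ennreal (u x))"
    and int_u2: "integrable ?L (\<lambda>x. (u x)\<^sup>2)"
    and L2_u: "L2_norm_squared \<Omega> \<mu> = ennreal (LINT x|?L. (u x)\<^sup>2)" by blast
  have "(LINT x|?L. u x) = (LINT x|\<mu>. 1)"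
    unfolding \<mu>_u using u0 by (subst integral_density) auto
  then have mass: "(LINT x|?L. u x) = (LINT x|?L. max 0 (c - p x))"
    using c by (simp add: \<mu>.prob_space)
  \<comment> \<open>The excess of the energy of \<open>u\<close> over \<open>G\<close> controls the distance \<open>S\<close> between the densities.\<close>
  define S where "S = (LINT x|?L. (u x - v x)\<^sup>2)"
  have int_S: "integrable ?L (\<lambda>x. (u x - v x)\<^sup>2)"
    and gap: "G + S / 2 \<le> (LINT x|?L. (u x)\<^sup>2) / 2 + (LINT x|?L. u x * p x)"
    using truncated_potential_strictly_optimal[OF L.finite_measure_axioms p_meas B u_meas u0 int_u2 mass]
    unfolding S_def G_def v_def by simp_all
  have S0: "0 \<le> S" unfolding S_def by (intro integral_nonneg_AE) auto
  \<comment> \<open>The upper and lower bounds meet, so both nonnegative remainders become arbitrarily small.\<close>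
  have plan: "\<exists>\<gamma>\<in>transport_plans \<Omega> \<mu> \<nu>. S / 2
      + (2 * l + 1) / 2 * (LINT z|\<gamma>. (norm (snd z - T (fst z)))\<^sup>2) \<le> e" if "e > 0" for e
  proof -
    have "0 \<le> (LINT x|?L. (u x)\<^sup>2)" "0 \<le> G"
      using G_nonneg by (auto intro!: integral_nonneg_AE simp: G_def)
    from ex_near_optimal_plan[OF \<Omega>(1) l \<mu> \<nu> L2_u this(1) F_le that this(2)]
    obtain \<gamma> where \<gamma>: "\<gamma> \<in> transport_plans \<Omega> \<mu> \<nu>" and
      "(LINT x|?L. (u x)\<^sup>2) / 2 + k * (LINT x|\<mu>. (norm (x - b))\<^sup>2)
        + (2 * l + 1) / 2 * (LINT z|\<gamma>. (norm (snd z - T (fst z)))\<^sup>2) \<le> G + e"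
      unfolding b_def[symmetric] k_def[symmetric] T_def[symmetric] by blast
    moreover have "k * (LINT x|\<mu>. (norm (x - b))\<^sup>2) = (LINT x|?L. u x * p x)"
      unfolding \<mu>_u by (rule weighted[OF u_meas u0])
    ultimately have "S / 2 + (2 * l + 1) / 2 * (LINT z|\<gamma>. (norm (snd z - T (fst z)))\<^sup>2) \<le> e"
      using gap by linarith
    with \<gamma> show ?thesis by blast
  qed
  have J0: "0 \<le> (LINT z|\<gamma>. (norm (snd z - T (fst z)))\<^sup>2)" for \<gamma>
    by (intro integral_nonneg_AE) auto

  have "S / 2 \<le> 0 + e" if e: "e > 0" for e
  proof -
    obtain \<gamma> where "S / 2 + (2 * l + 1) / 2 * (LINT z|\<gamma>. (norm (snd z - T (fst z)))\<^sup>2) \<le> e"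
      using plan[OF e] by blast
    moreover have "0 \<le> (2 * l + 1) / 2 * (LINT z|\<gamma>. (norm (snd z - T (fst z)))\<^sup>2)"
      using l J0 by (intro mult_nonneg_nonneg) auto
    ultimately show ?thesis by linarith
  qed
  then have "S / 2 \<le> 0" by (rule field_le_epsilon)
  with S0 have "S = 0" by simp
  then have "AE x in ?L. (u x - v x)\<^sup>2 = 0"
    using integral_nonneg_eq_0_iff_AE[OF int_S] by (simp add: S_def)
  then have "AE x in ?L. ennreal (u x) = ennreal (v x)" by eventually_elim simp
  then have \<mu>_v: "\<mu> = density ?L (\<lambda>x. ennreal (v x))"
    unfolding \<mu>_u by (intro density_cong) auto

  have \<nu>_T: "\<nu> = distr \<mu> ?B T"
  proof (rule distr_eqI_transport_plans[OF \<Omega>(1) \<mu> \<nu> T_cont T_into])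
    fix e :: real assume "e > 0"
    then have "e / 2 > 0" by simp
    from plan[OF this] obtain \<gamma> where \<gamma>: "\<gamma> \<in> transport_plans \<Omega> \<mu> \<nu>"
      and "S / 2 + (2 * l + 1) / 2 * (LINT z|\<gamma>. (norm (snd z - T (fst z)))\<^sup>2) \<le> e / 2" by blast
    moreover have "1 / 2 * (LINT z|\<gamma>. (norm (snd z - T (fst z)))\<^sup>2) \<le>
        (2 * l + 1) / 2 * (LINT z|\<gamma>. (norm (snd z - T (fst z)))\<^sup>2)"
      using l J0 by (intro mult_right_mono) auto
    ultimately show "\<exists>\<gamma>\<in>transport_plans \<Omega> \<mu> \<nu>. (LINT z|\<gamma>. (norm (snd z - T (fst z)))\<^sup>2) \<le> e"
      using S0 by (intro bexI[OF _ \<gamma>]) linarith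
  qed

  have AE_\<mu>: "AE x in \<mu>. x \<in> ball b r \<inter> \<Omega>"
    unfolding \<mu>_v using v_pos_iff
    by (subst AE_density) (auto intro!: AE_I2 simp: space_restrict_space)
  have T_ball: "T x \<in> ball b (r / (2 * l + 1))" if "x \<in> ball b r" for x
  proof -
    have "dist b (T x) = dist b x / (2 * l + 1)"
      using l by (simp add: T_def homothety_def dist_norm norm_minus_commute)
    then show ?thesis using that l by (simp add: divide_strict_right_mono)
  qed
  have "AE y in distr \<mu> ?B T. y \<in> ball b (r / (2 * l + 1))"
  proof (subst AE_distr_iff[OF borel_probs_measurable_restrict[OF \<mu> T_meas T_into]])
    show "{y \<in> space ?B. y \<in> ball b (r / (2 * l + 1))} \<in> sets ?B"
      by (auto simp: space_restrict_space sets_restrict_space)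
    show "AE x in \<mu>. T x \<in> ball b (r / (2 * l + 1))"
      using AE_\<mu> by eventually_elim (use T_ball in blast)
  qed
  then have AE_\<nu>: "AE y in \<nu>. y \<in> ball b (r / (2 * l + 1))"
    by (simp only: \<nu>_T[symmetric])
  have T_eq: "T = (\<lambda>x. b + (1 / (2 * l + 1)) *\<^sub>R (x - b))"
    by (simp add: T_def homothety_def fun_eq_iff)
  show ?thesis
    using AE_\<mu> AE_\<nu> \<mu>_v[folded v_eq] \<nu>_T[unfolded T_eq] b_def
    by (intro exI[of _ b] exI[of _ r] conjI r(1))
qed

end
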